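(* Let $C_1,C_2,\ldots,C_n,C_{n+1}=C_1$ be a closed chain of circles in the Euclidean plane with centers $M_1,\ldots,M_n$ (and $M_{n+1}=M_1$) such that for each $i=1,\ldots,n$ the circles $C_i$ and $C_{i+1}$ either intersect in two points or touch each other. Let $A_i,B_i$ be the intersection points of $C_i$ and $C_{i+1}$, where $A_i=B_i$ if $C_i$ touches $C_{i+1}$. Let $\delta_{A_i}:=\sphericalangle A_iM_iB_i$ and $\gamma_{A_i}:=\sphericalangle B_iM_{i+1}A_i$. Then the map $\varphi_A:=\varphi_{A_n}\circ\cdots\circ\varphi_{A_2}\circ\varphi_{A_1}$, where $\varphi_{A_i}:C_i\to C_{i+1}$ is the pivot map with pivot $A_i$, is the identity map on $C_1$ if and only if the sum of all transfer angles of the maps $\varphi_{A_i}$ is a multiple of $2\pi$, i.e., $$n\pi-\frac12\sum_{i=1}^n(\delta_{A_i}+\gamma_{A_i})=2k\pi$$ for an integer $k$.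
   Context: Pivot map: let $C,C'$ be two circles which intersect in two points or touch each other, and let $A$ be a common point. The map $\varphi_A:C\to C'$ is defined as follows. If $X\in C$, $X\ne A$, then $\varphi_A(X)$ is the second intersection point of the line $XA$ with $C'$ (equal to $A$ if this line is tangent to $C'$ at $A$). If $X=A$, then $\varphi_A(X)$ is the second intersection with $C'$ of the tangent to $C$ at $A$ (equal to $A$ if the circles touch at $A$). Transfer angle: let $M,M'$ be the centers of $C,C'$. For $X\in C$ let $X'$ be the point on $C'$ such that $\overrightarrow{M'X'}=\lambda\,\overrightarrow{MX}$ for some $\lambda>0$. The transfer angle of $\varphi_A$ is $\mu_A:=\sphericalangle X'M'\varphi_A(X)$; it does not depend on the choice of $X\in C$. Angle convention: $\sphericalangle PMQ$ is the oriented (counterclockwise) angle from the ray $MP$ to the ray $MQ$. Transfer angles are understood modulo $2\pi$, and the values $\delta_{A_i},\gamma_{A_i}$ are taken in $[0,2\pi)$; in particular $\delta_{A_i}=\gamma_{A_i}=0$ if $C_i$ and $C_{i+1}$ touch ($A_i=B_i$).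
   Formalization: The explicit formula is asserted only for chains with an even number of internal tangencies, since with δ=γ=0 it fails otherwise (three circles internally tangent at one point: identity map, but the formula gives 3π); the transfer-angle criterion is proved for all chains. *)

theory Defs
  imports "HOL-Analysis.Analysis"
begin

text \<open>
  The Euclidean plane is the type \<^typ>\<open>complex\<close>; the circle with centre \<open>M\<close> and radius
  \<open>r > 0\<close> is \<open>sphere M r\<close>.
\<close>

text \<open>Since \<^const>\<open>Arg2pi\<close> has values in \<open>[0, 2 pi)\<close>, so do all angles below.\<close>

definition oriented_angle :: "complex \<Rightarrow> complex \<Rightarrow> complex \<Rightarrow> real" where
  "oriented_angle P M Q = Arg2pi ((Q - M) / (P - M))"

definition tangent_line :: "complex \<Rightarrow> complex \<Rightarrow> complex set" where
  "tangent_line M A = {Y. (Y - A) \<bullet> (A - M) = 0}"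

text \<open>
  A line \<open>L\<close> through a point \<open>A\<close> of a circle \<open>S\<close> is tangent to \<open>S\<close> at \<open>A\<close> exactly if it
  has no further point in common with \<open>S\<close>.
\<close>

definition second_intersection :: "complex set \<Rightarrow> complex set \<Rightarrow> complex \<Rightarrow> complex" where
  "second_intersection L S A =
     (if L \<inter> S = {A} then A else (THE Y. Y \<in> L \<inter> S \<and> Y \<noteq> A))"

text \<open>
  The pivot map from \<open>sphere M r\<close> to \<open>sphere M' r'\<close> with pivot \<open>A\<close>, a common point of both.
  It is only meaningful on \<open>sphere M r\<close>, and on this set it does not refer to \<open>r\<close>.
\<close>

definition pivot_map :: "complex \<Rightarrow> complex \<Rightarrow> real \<Rightarrow> complex \<Rightarrow> complex \<Rightarrow> complex" where
  "pivot_map M M' r' A X =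
     second_intersection (if X = A then tangent_line M A else affine hull {X, A}) (sphere M' r') A"

text \<open>
  The transfer angle of the pivot map is the common value, for all \<open>X\<close> on the first circle,
  of the angle at \<open>M'\<close> from \<open>X'\<close> to the image of \<open>X\<close>, where \<open>X'\<close> is the point of the second
  circle in the direction of \<open>X - M\<close>.
\<close>

definition transfer_angle :: "complex \<Rightarrow> real \<Rightarrow> complex \<Rightarrow> real \<Rightarrow> complex \<Rightarrow> real" where
  "transfer_angle M r M' r' A =
     (THE \<mu>. \<forall>X \<in> sphere M r. \<forall>X' \<in> sphere M' r'.
        (\<exists>c>0. X' - M' = c *\<^sub>R (X - M)) \<longrightarrow> \<mu> = oriented_angle X' M' (pivot_map M M' r' A X))"

text \<open>
  With \<open>A = B\<close>, and hence \<open>\<delta> = \<gamma> = 0\<close>, the term \<open>pi - (\<delta> + \<gamma>) / 2\<close> is the transfer angle \<open>pi\<close> of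
  two externally touching circles, but it is off by \<open>pi\<close> from the transfer angle \<open>0\<close> of two
  internally touching ones. The total of these terms over a chain therefore agrees with the sum
  of the transfer angles modulo \<open>2 pi\<close> exactly if the number of internal tangencies is even.
\<close>

definition touch_internally :: "complex \<Rightarrow> real \<Rightarrow> complex \<Rightarrow> real \<Rightarrow> bool" where
  "touch_internally M r M' r' \<longleftrightarrow>
     (\<exists>P. sphere M r \<inter> sphere M' r' = {P}) \<and>
     (cball M r \<subseteq> cball M' r' \<or> cball M' r' \<subseteq> cball M r)"

end

theory Submission
  imports Defs
begin

text \<open>
  Reflecting \<open>A - M'\<close> in the perpendicular through \<open>M'\<close> to the line \<open>XA\<close> shows that the pivot map is
  the similarity \<open>X \<mapsto> M' + k (X - M)\<close> with \<open>k\<close> the conjugate of \<open>(A - M') / (A - M)\<close>. So the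
  composition multiplies \<open>X - M\<^sub>1\<close> by the product of the factors, which has modulus \<open>1\<close> as the chain
  is closed, and the transfer angle is the argument of \<open>k\<close>. In coordinates with the real axis along
  the line of centres, \<open>B\<close> is the conjugate of \<open>A\<close>, so \<open>\<delta> / 2\<close> and \<open>\<gamma> / 2\<close> are, modulo \<open>pi\<close> and up to sign, the arguments
  of \<open>A\<close> seen from the two centres, and \<open>pi - (\<delta> + \<gamma>) / 2\<close> is the argument of \<open>k\<close>, except for an
  additional \<open>pi\<close> at an internal tangency.
\<close>

section \<open>Second intersections of lines with a circle\<close>

text \<open>Along the line the circle equation is quadratic in the parameter, with roots 0 and
  \<open>s\<close>. The second point is the reflection of \<open>A\<close> in the perpendicular to
  \<open>d\<close> through \<open>M\<close>; the quotient \<open>d / cnj d\<close> sees only the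
  direction. For a tangent, \<open>s = 0\<close> and the two points coincide.\<close>

lemma sphere_Int_line:
  fixes d :: complex
  assumes "A \<in> sphere M r" "d \<noteq> 0"
  shows "range (\<lambda>t. A + t *\<^sub>R d) \<inter> sphere M r = {A, M - cnj (A - M) * d / cnj d}"
proof -
  define a where "a = A - M"
  define s where "s = - 2 * (a \<bullet> d) / (norm d)\<^sup>2"
  have on: "A + t *\<^sub>R d \<in> sphere M r \<longleftrightarrow> t = 0 \<or> t = s" for t
  proof -
    have "A + t *\<^sub>R d \<in> sphere M r \<longleftrightarrow> norm (a + t *\<^sub>R d) = norm a"
      using assms(1) by (auto simp: a_def dist_norm norm_minus_commute algebra_simps)
    also have "\<dots> \<longleftrightarrow> (a + t *\<^sub>R d) \<bullet> (a + t *\<^sub>R d) = a \<bullet> a"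
      by (simp add: norm_eq)
    also have "\<dots> \<longleftrightarrow> t * (2 * (a \<bullet> d) + t * (norm d)\<^sup>2) = 0"
      by (simp add: inner_add_left inner_add_right inner_commute power2_norm_eq_inner algebra_simps)
    also have "\<dots> \<longleftrightarrow> t = 0 \<or> t = s"
      unfolding mult_eq_0_iff using assms(2) by (auto simp: s_def field_simps add_eq_0_iff)
    finally show ?thesis .
  qed
  have "of_real s = - (a * cnj d + cnj a * d) / (d * cnj d)"
  proof -
    have "a * cnj d + cnj a * d = of_real (2 * (a \<bullet> d))"
      by (simp add: complex_eq_iff inner_complex_def)
    then show ?thesis
      by (simp add: s_def flip: complex_norm_square)
  qed
  then have "A + s *\<^sub>R d = M - cnj (A - M) * d / cnj d"
    using assms(2) by (simp add: scaleR_conv_of_real a_def field_simps)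
  moreover have "range (\<lambda>t. A + t *\<^sub>R d) \<inter> sphere M r = (\<lambda>t. A + t *\<^sub>R d) ` {0, s}"
    using on by blast
  ultimately show ?thesis by simp
qed

lemma second_intersection_eq:
  assumes "L \<inter> S = {A, Y}"
  shows "second_intersection L S A = Y"
proof (cases "Y = A")
  case False
  then have "(THE Z. Z \<in> L \<inter> S \<and> Z \<noteq> A) = Y"
    using assms by (intro the_equality) auto
  then show ?thesis
    using False assms by (auto simp: second_intersection_def)
qed (use assms in \<open>simp add: second_intersection_def\<close>)

lemma tangent_line_eq_range:
  assumes "A \<noteq> M"
  shows "tangent_line M A = range (\<lambda>t. A + t *\<^sub>R (\<i> * (A - M)))"
proof -
  define a where "a = A - M"
  have a: "a \<noteq> 0" and M: "M = A - a"
    using assms by (auto simp: a_def)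
  have "\<exists>t. Y - A = t *\<^sub>R (\<i> * a)" if "(Y - A) \<bullet> a = 0" for Y
  proof -
    have "Re ((Y - A) / a) = 0"
      using that by (simp add: Re_divide inner_complex_def)
    then have "(Y - A) / a = \<i> * of_real (Im ((Y - A) / a))"
      by (simp add: complex_eq_iff)
    then show ?thesis
      using a by (intro exI[of _ "Im ((Y - A) / a)"]) (simp add: scaleR_conv_of_real field_simps)
  qed
  moreover have "(t *\<^sub>R (\<i> * a)) \<bullet> a = 0" for t
    by (simp add: inner_complex_def)
  ultimately show ?thesis
    unfolding tangent_line_def M by (fastforce simp: image_iff algebra_simps)
qed

section \<open>The pivot map as a similarity\<close>

definition pivot_factor :: "complex \<Rightarrow> complex \<Rightarrow> complex \<Rightarrow> complex" where
  "pivot_factor M M' A = cnj ((A - M') / (A - M))"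

lemma pivot_map_eq:
  assumes "0 < r" "A \<in> sphere M r" "A \<in> sphere M' r'" "X \<in> sphere M r"
  shows "pivot_map M M' r' A X = M' + pivot_factor M M' A * (X - M)"
proof -
  define d where "d = (if X = A then \<i> * (A - M) else A - X)"
  have AM: "A \<noteq> M" using assms by auto
  then have d: "d \<noteq> 0" by (simp add: d_def)
  have "affine hull {X, A} = range (\<lambda>t. A + t *\<^sub>R (A - X))"
  proof -
    have "affine hull {X, A} = range (\<lambda>t. A + t *\<^sub>R (X - A))"
      by (metis affine_hull_2_alt insert_commute)
    also have "\<dots> = range (\<lambda>t. A + t *\<^sub>R (A - X))"
      by (auto simp: image_iff) (metis minus_diff_eq scaleR_minus_left scaleR_minus_right)+
    finally show ?thesis .
  qed
  then have line: "(if X = A then tangent_line M A else affine hull {X, A})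
      = range (\<lambda>t. A + t *\<^sub>R d)"
    using tangent_line_eq_range[OF AM] by (simp add: d_def)
  \<comment> \<open>In the first circle the same reflection takes \<open>A - M\<close> to
    \<open>X - M\<close>, also when \<open>X = A\<close> and the line is tangent. This expresses
    \<open>d / cnj d\<close> through \<open>X\<close>, which removes \<open>d\<close> from the image
    point.\<close>
  have dir: "d * cnj (A - M) = - (X - M) * cnj d"
  proof (cases "X = A")
    case False
    have "(X - M) * cnj (X - M) = (A - M) * cnj (A - M)"
      using assms by (simp add: complex_norm_square[symmetric] dist_norm norm_minus_commute
          del: complex_cnj_diff)
    then show ?thesis using False by (simp add: d_def algebra_simps)
  qed (simp add: d_def algebra_simps)
  have "pivot_map M M' r' A X = M' - cnj (A - M') * d / cnj d"
    unfolding pivot_map_def line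
    by (rule second_intersection_eq[OF sphere_Int_line[OF assms(3) d]])
  moreover have "- (cnj (A - M') * d / cnj d) = pivot_factor M M' A * (X - M)"
  proof -
    have "cnj (A - M) \<noteq> 0" using AM by simp
    then have "d / cnj d = - (X - M) / cnj (A - M)"
      using dir d by (simp add: field_simps del: complex_cnj_diff)
    then have "- (cnj (A - M') * (d / cnj d)) = cnj (A - M') * ((X - M) / cnj (A - M))"
      by (metis minus_mult_right minus_divide_left minus_minus)
    then show ?thesis by (simp add: pivot_factor_def)
  qed
  ultimately show ?thesis by (simp add: algebra_simps)
qed

lemma pivot_map_in_sphere:
  assumes "0 < r" "A \<in> sphere M r" "A \<in> sphere M' r'" "X \<in> sphere M r"
  shows "M' + pivot_factor M M' A * (X - M) \<in> sphere M' r'"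
  using assms by (auto simp: pivot_factor_def norm_divide norm_mult dist_norm norm_minus_commute
      simp del: complex_cnj_diff complex_cnj_divide)

text \<open>A positive stretch does not change the argument, and \<open>X - M\<close> cancels in the
  quotient, so every \<open>X\<close> gives the same angle.\<close>

lemma transfer_angle_eq:
  assumes "0 < r" "0 < r'" "A \<in> sphere M r" "A \<in> sphere M' r'"
  shows "transfer_angle M r M' r' A = Arg2pi (pivot_factor M M' A)"
proof -
  let ?k = "pivot_factor M M' A"
  have angle: "oriented_angle X' M' (pivot_map M M' r' A X) = Arg2pi ?k"
    if "X \<in> sphere M r" "X' - M' = c *\<^sub>R (X - M)" "c > 0" for X X' c
  proof -
    have "X \<noteq> M" using that(1) assms(1) by auto
    then have "?k * (X - M) / (c *\<^sub>R (X - M)) = ?k / of_real c"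
      using that(3) by (simp add: scaleR_conv_of_real)
    then show ?thesis
      using that pivot_map_eq[OF assms(1,3,4) that(1)] by (simp add: oriented_angle_def)
  qed
  \<comment> \<open>For uniqueness under \<open>THE\<close>: this pair, with stretch
    \<open>r' / r\<close>, shows that the defining condition is not vacuous.\<close>
  have in_sphere: "A \<in> sphere M r" "M' + (r' / r) *\<^sub>R (A - M) \<in> sphere M' r'"
    using assms by (auto simp: dist_norm norm_minus_commute)
  show ?thesis
    unfolding transfer_angle_def
  proof (rule the_equality)
    fix \<mu> assume \<mu>: "\<forall>X\<in>sphere M r. \<forall>X'\<in>sphere M' r'. (\<exists>c>0. X' - M' = c *\<^sub>R (X - M)) \<longrightarrow>
        \<mu> = oriented_angle X' M' (pivot_map M M' r' A X)"
    have "r' / r > 0" using assms by simp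
    moreover have "M' + (r' / r) *\<^sub>R (A - M) - M' = (r' / r) *\<^sub>R (A - M)" by simp
    ultimately show "\<mu> = Arg2pi ?k"
      using \<mu> in_sphere angle by metis
  qed (use angle in metis)
qed

section \<open>Directions of complex numbers and half angles\<close>

lemma cis_Arg2pi:
  assumes "z \<noteq> 0"
  shows "cis (Arg2pi z) = sgn z"
  using Arg2pi_eq[of z] assms
  by (simp add: sgn_eq cis_conv_exp field_simps)

lemma cis_sum: "cis (\<Sum>i\<in>I. f i) = (\<Prod>i\<in>I. cis (f i))"
  by (induction I rule: infinite_finite_induct) (simp_all flip: cis_mult)

lemma sgn_prod: "sgn (\<Prod>i\<in>I. f i :: complex) = (\<Prod>i\<in>I. sgn (f i))"
  by (induction I rule: infinite_finite_induct) (auto simp: sgn_mult)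

lemma cis_eq_1_iff: "cis x = 1 \<longleftrightarrow> (\<exists>k::int. x = 2 * of_int k * pi)"
  using cos_one_2pi_int[of x] cos_one_sin_zero[of x]
  by (auto simp: complex_eq_iff mult_ac)

text \<open>The half angle lies in \<open>[0, pi)\<close>, so among the square roots of \<open>u\<^sup>2\<close> it selects the one in
  the upper half plane, or \<open>1\<close> rather than \<open>-1\<close>.\<close>

lemma cis_half_Arg2pi_square:
  assumes "norm u = 1"
  shows "cis (Arg2pi (u\<^sup>2) / 2) = (if Im u > 0 \<or> u = 1 then u else - u)"
proof -
  define c where "c = cis (Arg2pi (u\<^sup>2) / 2)"
  have "u \<noteq> 0" using assms by auto
  have "c\<^sup>2 = u\<^sup>2"
    using cis_Arg2pi[of "u\<^sup>2"] \<open>u \<noteq> 0\<close> assms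
    by (simp add: c_def power2_eq_square cis_mult sgn_eq norm_mult)
  then have c: "c = u \<or> c = - u" by (simp add: power2_eq_iff)
  have range: "0 \<le> Arg2pi (u\<^sup>2) / 2" "Arg2pi (u\<^sup>2) / 2 < pi"
    using Arg2pi_ge_0[of "u\<^sup>2"] Arg2pi_lt_2pi[of "u\<^sup>2"] by auto
  then have Im: "Im c \<ge> 0" by (simp add: c_def sin_ge_zero)
  show ?thesis
  proof (cases "Im u = 0")
    case True
    then have "u = 1 \<or> u = -1"
      using assms by (auto simp: complex_eq_iff cmod_eq_Re)
    then show ?thesis using Arg2pi_of_real[of 1] by auto
  next
    case False
    then show ?thesis using c Im unfolding c_def[symmetric] by auto
  qed
qed

section \<open>Common points in coordinates along the line of centres\<close>

text \<open>Concentric circles with a common point coincide, and a circle has at least three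
  points.\<close>

lemma centres_distinct:
  fixes M :: complex
  assumes "0 < r" "sphere M r \<inter> sphere M' r' = {A, B}"
  shows "M \<noteq> M'"
proof
  assume "M = M'"
  moreover have "A \<in> sphere M r" "A \<in> sphere M' r'" using assms(2) by blast+
  ultimately have "sphere M r = {A, B}" using assms(2) by auto
  moreover have "{M + of_real r, M - of_real r, M + \<i> * of_real r} \<subseteq> sphere M r"
    using assms(1) by (simp add: dist_norm norm_mult)
  ultimately have "card {M + of_real r, M - of_real r, M + \<i> * of_real r} \<le> card {A, B}"
    by (metis card_mono finite.emptyI finite.insertI)
  also have "\<dots> \<le> 2" by (simp add: card_insert_if)
  finally show False
    using assms(1) by (simp add: card_insert_if complex_eq_iff)
qed

text \<open>A coordinate system with origin \<open>M\<close> whose positive real axis passes through \<open>M'\<close>; in it,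
  the two common points are complex conjugates.\<close>

lemma centre_line_coordinates:
  assumes "0 < r" "sphere M r \<inter> sphere M' r' = {A, B}"
  obtains m p p' where "norm m = 1" "dist M M' > 0" "p - p' = of_real (dist M M')"
    "norm p = r" "norm p' = r'"
    "A - M = m * p" "B - M = m * cnj p" "A - M' = m * p'" "B - M' = m * cnj p'"
proof -
  define D where "D = dist M M'"
  define m where "m = sgn (M' - M)"
  define p where "p = (A - M) / m"
  define q where "q = (B - M) / m"
  have "M \<noteq> M'" using centres_distinct[OF assms] .
  then have m: "norm m = 1" and D: "D > 0"
    by (auto simp: m_def D_def norm_sgn)
  have m0: "m \<noteq> 0" using m by auto
  have M': "M' = M + m * of_real D"
    using \<open>M \<noteq> M'\<close> by (simp add: m_def D_def sgn_eq dist_norm norm_minus_commute)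
  have on: "M + m * z \<in> sphere M r \<inter> sphere M' r' \<longleftrightarrow> norm z = r \<and> norm (z - of_real D) = r'"
    for z
  proof -
    have "M' - (M + m * z) = - (m * (z - of_real D))" by (simp add: M' algebra_simps)
    then show ?thesis by (simp add: dist_norm norm_mult m)
  qed
  have A: "A = M + m * p" and B: "B = M + m * q" using m0 by (simp_all add: p_def q_def)
  have p: "norm p = r" "norm (p - of_real D) = r'" and q: "norm q = r" "norm (q - of_real D) = r'"
    using on[of p] on[of q] A B assms(2) by auto
  have "norm (cnj p - of_real D) = r'"
    using p(2) by (metis complex_cnj_complex_of_real complex_cnj_diff complex_mod_cnj)
  then have cnj_p: "M + m * cnj p \<in> {A, B}"
    using p(1) on[of "cnj p"] assms(2) by simp
  have "(Re p)\<^sup>2 + (Im p)\<^sup>2 = (Re q)\<^sup>2 + (Im q)\<^sup>2"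
    using p(1) q(1) cmod_power2 by metis
  moreover have "(Re p - D)\<^sup>2 + (Im p)\<^sup>2 = (Re q - D)\<^sup>2 + (Im q)\<^sup>2"
    using p(2) q(2) cmod_power2[of "p - of_real D"] cmod_power2[of "q - of_real D"] by simp
  \<comment> \<open>Subtracting the two circle equations leaves a linear one: common points lie on a
    perpendicular to the line of centres.\<close>
  ultimately have "D * Re p = D * Re q"
    unfolding power2_diff by argo
  then have Re: "Re p = Re q" using D by simp
  then have "q = p \<or> q = cnj p"
    using \<open>(Re p)\<^sup>2 + _ = _\<close> by (auto simp: complex_eq_iff power2_eq_iff)
  \<comment> \<open>If \<open>q = p\<close>, then \<open>A = B\<close> is the only common point, so
    \<open>cnj_p\<close> makes \<open>p\<close> real and \<open>q = cnj p\<close> holds as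
    well.\<close>
  then have "q = cnj p" using cnj_p A B m0 by auto
  then have B': "B = M + m * cnj p" using B by simp
  show thesis
  proof (rule that[of m p "p - of_real D"])
    show "A - M = m * p" "B - M = m * cnj p"
      unfolding A B' by simp_all
    show "A - M' = m * (p - of_real D)" "B - M' = m * cnj (p - of_real D)"
      unfolding A B' M' by (simp_all add: right_diff_distrib)
  qed (use m D p in \<open>simp_all add: D_def\<close>)
qed

text \<open>Here \<open>x\<close> and \<open>y\<close> are the signed positions of the contact point
  seen from the two centres. For equal signs the distance of the centres is the difference of the
  radii, for opposite signs it is their sum.\<close>

lemma touch_internally_real:
  fixes x y :: real
  assumes "dist M M' > 0" "x - y = dist M M'" "x \<noteq> 0" "y \<noteq> 0"
    and "sphere M \<bar>x\<bar> \<inter> sphere M' \<bar>y\<bar> = {P}"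
  shows "touch_internally M \<bar>x\<bar> M' \<bar>y\<bar> \<longleftrightarrow> sgn x = sgn y"
proof -
  have "touch_internally M \<bar>x\<bar> M' \<bar>y\<bar> \<longleftrightarrow>
      dist M M' + \<bar>x\<bar> \<le> \<bar>y\<bar> \<or> dist M M' + \<bar>y\<bar> \<le> \<bar>x\<bar>"
    using assms(5) unfolding touch_internally_def cball_subset_cball_iff
    by (simp add: dist_commute)
  also have "\<dots> \<longleftrightarrow> sgn x = sgn y"
    using assms(1-4) unfolding sgn_if by (smt (verit))
  finally show ?thesis .
qed

text \<open>The direction of the factor is \<open>1 / (u * v)\<close>, and the half angles give
  \<open>u\<close> and \<open>v\<close> up to sign. At a crossing exactly one sign flips, which
  cancels the -1 coming from \<open>pi\<close>. At a tangency both half angles vanish, so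
  \<open>cis\<close> gives -1, whereas \<open>1 / (u * v)\<close> is 1 if the contact is
  internal.\<close>

lemma sgn_pivot_factor:
  assumes "0 < r" "0 < r'" "sphere M r \<inter> sphere M' r' = {A, B}"
  shows "sgn (pivot_factor M M' A) = (if touch_internally M r M' r' then -1 else 1) *
    cis (pi - (oriented_angle A M B + oriented_angle B M' A) / 2)"
proof -
  obtain m p p' where m: "norm m = 1" and D: "dist M M' > 0" "p - p' = of_real (dist M M')"
    and norms: "norm p = r" "norm p' = r'"
    and points: "A - M = m * p" "B - M = m * cnj p" "A - M' = m * p'" "B - M' = m * cnj p'"
    using centre_line_coordinates[OF assms(1,3)] by metis
  \<comment> \<open>The conjugate sits on \<open>p\<close> only, since the first angle runs from
    \<open>A\<close> to \<open>B\<close> and the second from \<open>B\<close> to \<open>A\<close>;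
    their arguments are those of the squares of \<open>u\<close> and \<open>v\<close>.\<close>
  define u where "u = sgn (cnj p)"
  define v where "v = sgn p'"
  have m0: "m \<noteq> 0" and p0: "p \<noteq> 0" and p'0: "p' \<noteq> 0" using m norms assms by auto
  have unit: "norm u = 1" "norm v = 1" using p0 p'0 by (auto simp: u_def v_def norm_sgn)
  have uv0: "u \<noteq> 0" "v \<noteq> 0" using unit by auto
  \<comment> \<open>The difference \<open>p - p'\<close> is real, so \<open>u\<close> and
    \<open>v\<close> have imaginary parts of opposite signs unless both are real.\<close>
  have Im: "Im p = Im p'" using D(2) by (simp add: complex_eq_iff)
  have Im_u: "Im u = - Im p / r" and Im_v: "Im v = Im p / r'"
    using norms Im by (simp_all add: u_def v_def sgn_eq)
  have sgn_square: "(sgn z)\<^sup>2 = z / cnj z" if "z \<noteq> 0" for z :: complex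
    using that complex_norm_square[of z]
    by (simp add: sgn_eq power_divide) (simp add: power2_eq_square)
  have "oriented_angle A M B = Arg2pi (u\<^sup>2)"
    using sgn_square[of "cnj p"] p0 m0 by (simp add: oriented_angle_def points u_def)
  moreover have "oriented_angle B M' A = Arg2pi (v\<^sup>2)"
    using sgn_square[of p'] p'0 m0 by (simp add: oriented_angle_def points v_def)
  ultimately have "cis (pi - (oriented_angle A M B + oriented_angle B M' A) / 2) =
      - 1 / (cis (Arg2pi (u\<^sup>2) / 2) * cis (Arg2pi (v\<^sup>2) / 2))"
    by (simp add: cis_mult add_divide_distrib flip: cis_divide)
  also have "\<dots> = - 1 / ((if Im u > 0 \<or> u = 1 then u else - u) * (if Im v > 0 \<or> v = 1 then v else - v))"
    by (simp only: cis_half_Arg2pi_square unit)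
  finally have half: "cis (pi - (oriented_angle A M B + oriented_angle B M' A) / 2) = \<dots>" .
  have k: "sgn (pivot_factor M M' A) = 1 / (u * v)"
  proof -
    have "pivot_factor M M' A = cnj p' / cnj p"
      using m0 by (simp add: pivot_factor_def points)
    then have "sgn (pivot_factor M M' A) = sgn (cnj p') / u"
      by (simp add: u_def sgn_divide)
    moreover have "sgn (cnj p') * v = 1"
      using p'0 complex_norm_square[of p'] by (simp add: v_def sgn_eq power2_eq_square)
    then have "sgn (cnj p') = 1 / v" using uv0 by (simp add: field_simps)
    ultimately show ?thesis by simp
  qed
  have crossing: "\<not> touch_internally M r M' r'" if "Im p \<noteq> 0"
  proof -
    have "p \<noteq> cnj p" using that by (simp add: complex_eq_iff)
    then have "m * p \<noteq> m * cnj p" using m0 by simp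
    then have "A \<noteq> B" using points by metis
    then show ?thesis using assms(3) by (auto simp: touch_internally_def)
  qed
  consider "Im p > 0" | "Im p < 0" | "Im p = 0" by linarith
  then show ?thesis
  proof cases
    case 3
    define x y where "x = Re p" and "y = Re p'"
    have p: "p = of_real x" and p': "p' = of_real y"
      using 3 Im by (simp_all add: complex_eq_iff x_def y_def)
    have xy: "x \<noteq> 0" "y \<noteq> 0" "\<bar>x\<bar> = r" "\<bar>y\<bar> = r'" "x - y = dist M M'"
      using p0 p'0 norms D(2) unfolding p p' by (auto simp flip: of_real_diff)
    have "A = B" using points(1,2) p 
      by (metis complex_cnj_complex_of_real diff_add_cancel)
    then have "touch_internally M \<bar>x\<bar> M' \<bar>y\<bar> \<longleftrightarrow> sgn x = sgn y"
      using assms(3) by (intro touch_internally_real[OF D(1) xy(5,1,2), of A]) (simp add: xy(3,4))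
    then have touch: "touch_internally M r M' r' \<longleftrightarrow> sgn x = sgn y"
      by (simp only: xy(3,4))
    have uv: "u = of_real (sgn x)" "v = of_real (sgn y)"
      by (simp_all add: u_def v_def p p' sgn_of_real)
    show ?thesis
      unfolding half k touch using xy(1,2) by (auto simp: uv sgn_if)
  next
    case 1
    then have "\<not> touch_internally M r M' r'" using crossing by simp
    moreover have "Im u < 0" "Im v > 0" using 1 assms by (simp_all add: Im_u Im_v)
    ultimately show ?thesis unfolding half k using uv0 by auto
  next
    case 2
    then have "\<not> touch_internally M r M' r'" using crossing by simp
    moreover have "Im u > 0" "Im v < 0" using 2 assms by (simp_all add: Im_u Im_v divide_neg_pos)
    ultimately show ?thesis unfolding half k using uv0 by auto
  qed
qed

section \<open>Composition along the chain\<close>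

text \<open>The chain is left open so that the induction can pass to initial segments. Membership in
  the last circle is carried along because the next pivot map is a similarity only on its own
  circle.\<close>

lemma fold_pivot_maps:
  assumes radii: "\<And>i. i \<in> {1..n} \<Longrightarrow> r i > 0"
    and pivots: "\<And>i. i \<in> {1..n} \<Longrightarrow> A i \<in> sphere (M i) (r i) \<inter> sphere (M (i + 1)) (r (i + 1))"
    and phi: "\<And>i. i \<in> {1..n} \<Longrightarrow> \<phi> i = pivot_map (M i) (M (i + 1)) (r (i + 1)) (A i)"
    and X: "X \<in> sphere (M 1) (r 1)"
  shows "fold \<phi> [1..<n + 1] X = M (n + 1) + (\<Prod>i=1..n. pivot_factor (M i) (M (i + 1)) (A i)) * (X - M 1)
    \<and> fold \<phi> [1..<n + 1] X \<in> sphere (M (n + 1)) (r (n + 1))"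
  using radii pivots phi
proof (induction n)
  case (Suc n)
  define Y where "Y = fold \<phi> [1..<n + 1] X"
  have Y: "Y = M (n + 1) + (\<Prod>i=1..n. pivot_factor (M i) (M (i + 1)) (A i)) * (X - M 1)"
    "Y \<in> sphere (M (n + 1)) (r (n + 1))"
    using Suc.IH Suc.prems by (auto simp: Y_def)
  have on: "0 < r (n + 1)" "A (n + 1) \<in> sphere (M (n + 1)) (r (n + 1))"
    "A (n + 1) \<in> sphere (M (n + 2)) (r (n + 2))"
    using Suc.prems(1)[of "n + 1"] Suc.prems(2)[of "n + 1"] by auto
  have "fold \<phi> [1..<Suc n + 1] X = pivot_map (M (n + 1)) (M (n + 2)) (r (n + 2)) (A (n + 1)) Y"
    using Suc.prems(3)[of "n + 1"] by (simp add: Y_def)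
  also have "\<dots> = M (n + 2) + pivot_factor (M (n + 1)) (M (n + 2)) (A (n + 1)) * (Y - M (n + 1))"
    using pivot_map_eq on Y(2) by blast
  finally show ?case
    using pivot_map_in_sphere[OF on Y(2)] Y(1) by (simp add: mult_ac)
qed (use X in simp)

theorem theorem7:
  fixes n :: nat
    and M A B :: "nat \<Rightarrow> complex"
    and r \<delta> \<gamma> :: "nat \<Rightarrow> real"
    and \<phi> :: "nat \<Rightarrow> complex \<Rightarrow> complex"
  assumes "n \<ge> 1"
    and radii: "\<And>i. i \<in> {1..n} \<Longrightarrow> r i > 0"
    and closed: "M (n + 1) = M 1" "r (n + 1) = r 1"
    and common_points:
      "\<And>i. i \<in> {1..n} \<Longrightarrow> sphere (M i) (r i) \<inter> sphere (M (i + 1)) (r (i + 1)) = {A i, B i}"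
    and delta: "\<And>i. i \<in> {1..n} \<Longrightarrow> \<delta> i = oriented_angle (A i) (M i) (B i)"
    and gamma: "\<And>i. i \<in> {1..n} \<Longrightarrow> \<gamma> i = oriented_angle (B i) (M (i + 1)) (A i)"
    and phi: "\<And>i. i \<in> {1..n} \<Longrightarrow> \<phi> i = pivot_map (M i) (M (i + 1)) (r (i + 1)) (A i)"
  shows
    "((\<forall>X \<in> sphere (M 1) (r 1). fold \<phi> [1..<n + 1] X = X) \<longleftrightarrow>
        (\<exists>k::int. (\<Sum>i=1..n. transfer_angle (M i) (r i) (M (i + 1)) (r (i + 1)) (A i))
                  = 2 * of_int k * pi)) \<and>
     (even (card {i \<in> {1..n}. touch_internally (M i) (r i) (M (i + 1)) (r (i + 1))}) \<longrightarrow>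
       ((\<forall>X \<in> sphere (M 1) (r 1). fold \<phi> [1..<n + 1] X = X) \<longleftrightarrow>
        (\<exists>k::int. real n * pi - 1/2 * (\<Sum>i=1..n. \<delta> i + \<gamma> i) = 2 * of_int k * pi)))"
proof -
  define k where "k i = pivot_factor (M i) (M (i + 1)) (A i)" for i
  define K where "K = (\<Prod>i=1..n. k i)"
  let ?int = "\<lambda>i. touch_internally (M i) (r i) (M (i + 1)) (r (i + 1))"
  have pivots: "A i \<in> sphere (M i) (r i) \<inter> sphere (M (i + 1)) (r (i + 1))" if "i \<in> {1..n}" for i
    using common_points[OF that] by simp
  have next_radius: "r (i + 1) > 0" if "i \<in> {1..n}" for i
    using that radii[of "i + 1"] radii[of 1] closed(2) by (cases "i = n") auto
  have k0: "k i \<noteq> 0" if "i \<in> {1..n}" for i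
    using pivots[OF that] radii[OF that] next_radius[OF that] by (auto simp: k_def pivot_factor_def)
  have r1: "r 1 > 0" using radii \<open>n \<ge> 1\<close> by simp
  have folded: "fold \<phi> [1..<n + 1] X = M (n + 1) + (\<Prod>i=1..n. pivot_factor (M i) (M (i + 1)) (A i)) * (X - M 1)
      \<and> fold \<phi> [1..<n + 1] X \<in> sphere (M (n + 1)) (r (n + 1))"
    if "X \<in> sphere (M 1) (r 1)" for X
    by (rule fold_pivot_maps) (use radii pivots phi that in blast)+
  have fold_eq: "fold \<phi> [1..<n + 1] X = M 1 + K * (X - M 1)"
    and fold_on: "fold \<phi> [1..<n + 1] X \<in> sphere (M 1) (r 1)" if "X \<in> sphere (M 1) (r 1)" for X
    using folded[OF that] unfolding closed K_def k_def by blast+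
  \<comment> \<open>A concrete point off the centre: as it and its image lie on the same circle,
    \<open>K\<close> has modulus 1, and if it is fixed, then \<open>K = 1\<close>.\<close>
  define X0 where "X0 = M 1 + of_real (r 1)"
  have X0: "X0 \<in> sphere (M 1) (r 1)" using r1 by (simp add: X0_def dist_norm)
  have "norm (K * of_real (r 1)) = r 1"
    using fold_on[OF X0] unfolding fold_eq[OF X0] by (simp add: X0_def dist_norm)
  then have "norm K = 1" using r1 by (simp add: norm_mult)
  then have sgn_K: "(\<Prod>i=1..n. sgn (k i)) = K" by (metis K_def div_by_1 of_real_1 sgn_eq sgn_prod)
  have identity: "(\<forall>X \<in> sphere (M 1) (r 1). fold \<phi> [1..<n + 1] X = X) \<longleftrightarrow> K = 1"
  proof
    assume "\<forall>X \<in> sphere (M 1) (r 1). fold \<phi> [1..<n + 1] X = X"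
    then have "M 1 + K * (X0 - M 1) = X0"
      using X0 fold_eq[OF X0] by metis
    then show "K = 1" using r1 by (simp add: X0_def)
  next
    assume "K = 1"
    show "\<forall>X \<in> sphere (M 1) (r 1). fold \<phi> [1..<n + 1] X = X"
    proof
      fix X assume "X \<in> sphere (M 1) (r 1)"
      then have "fold \<phi> [1..<n + 1] X = M 1 + K * (X - M 1)" by (rule fold_eq)
      also have "\<dots> = X" using \<open>K = 1\<close> by simp
      finally show "fold \<phi> [1..<n + 1] X = X" .
    qed
  qed
  have "cis (\<Sum>i=1..n. transfer_angle (M i) (r i) (M (i + 1)) (r (i + 1)) (A i)) = K"
    unfolding cis_sum sgn_K[symmetric]
  proof (rule prod.cong)
    fix i assume i: "i \<in> {1..n}"
    have "transfer_angle (M i) (r i) (M (i + 1)) (r (i + 1)) (A i) = Arg2pi (k i)"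
      unfolding k_def using transfer_angle_eq radii[OF i] next_radius[OF i] pivots[OF i] by blast
    then show "cis (transfer_angle (M i) (r i) (M (i + 1)) (r (i + 1)) (A i)) = sgn (k i)"
      using cis_Arg2pi[OF k0[OF i]] by simp
  qed simp
  then have transfer: "(\<exists>j::int. (\<Sum>i=1..n. transfer_angle (M i) (r i) (M (i + 1)) (r (i + 1)) (A i))
      = 2 * of_int j * pi) \<longleftrightarrow> K = 1"
    by (simp only: cis_eq_1_iff[symmetric])
  have half_angles: "(\<exists>j::int. real n * pi - 1/2 * (\<Sum>i=1..n. \<delta> i + \<gamma> i) = 2 * of_int j * pi) \<longleftrightarrow> K = 1"
    if "even (card {i \<in> {1..n}. ?int i})"
  proof -
    \<comment> \<open>Each internal tangency contributes a factor -1; an even number of them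
      cancels.\<close>
    have "K = (\<Prod>i=1..n. (if ?int i then -1 else 1) * cis (pi - (\<delta> i + \<gamma> i) / 2))"
      unfolding sgn_K[symmetric]
    proof (rule prod.cong)
      fix i assume i: "i \<in> {1..n}"
      show "sgn (k i) = (if ?int i then -1 else 1) * cis (pi - (\<delta> i + \<gamma> i) / 2)"
        unfolding k_def delta[OF i] gamma[OF i]
        using sgn_pivot_factor[OF radii[OF i] next_radius[OF i] common_points[OF i]] .
    qed simp
    also have "\<dots> = (\<Prod>i=1..n. if ?int i then -1 else 1) * cis (\<Sum>i=1..n. pi - (\<delta> i + \<gamma> i) / 2)"
      by (simp add: prod.distrib cis_sum)
    also have "(\<Prod>i=1..n. if ?int i then -1 else 1) = (-1 :: complex) ^ card {i \<in> {1..n}. ?int i}"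
      by (simp add: prod.If_cases Int_def)
    also have "(\<Sum>i=1..n. pi - (\<delta> i + \<gamma> i) / 2) = real n * pi - 1/2 * (\<Sum>i=1..n. \<delta> i + \<gamma> i)"
      by (simp add: sum_subtractf sum_divide_distrib)
    finally show ?thesis using that by (simp only: cis_eq_1_iff[symmetric]) simp
  qed
  show ?thesis
    unfolding identity transfer by (intro conjI refl impI) (erule half_angles[symmetric])
qed

end
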